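(* Let $G=(V,E)$ be a finite simple undirected graph on $n\ge2$ nodes and $\varepsilon>0$, and let $\mathscr{C}$ be an FE cover. Then $|\mathscr{C}|\le\lceil\log_{1+\varepsilon}(n)\rceil$.
   Context: The LambdaPrime LP relaxation with parameter $\lambda>0$ has variables $x_{ij}$ for unordered pairs $i<j$: minimize $\sum_{(i,j)\in E}x_{ij}+\sum_{i<j}\lambda(1-x_{ij})$ subject to $x_{ij}\le x_{ik}+x_{jk}$ and $0\le x_{ij}\le1$; $x$ is $(1+\varepsilon)$-approximate at $\lambda$ if its value at $\lambda$ is at most $(1+\varepsilon)$ times the optimum at $\lambda$. An FE cover is an output of the FE algorithm: set $\mathscr{C}=\emptyset$, $\lambda_0=4/n^2$; while $\lambda_0<1$: take an optimal LP solution $x^*$ at $\lambda_0$, let $\lambda_+$ be the largest $\lambda\ge\lambda_0$ at which $x^*$ is $(1+\varepsilon)$-approximate, add $x^*$ to $\mathscr{C}$, set $\lambda_0\leftarrow(1+\varepsilon)\lambda_+$; afterwards, if $\lambda_+<1$ add an optimal LP solution at $\lambda_+$; return $\mathscr{C}$. *)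

theory Defs
  imports Complex_Main "HOL-Library.FuncSet" "HOL-Library.Ramsey" "HOL-Library.Extended_Real"
begin

definition simple_graph :: "'a set \<Rightarrow> 'a set set \<Rightarrow> bool" where
  "simple_graph V E \<longleftrightarrow> finite V \<and> E \<subseteq> nsets V 2"

text \<open>
  The variable of the unordered pair of nodes \<open>i\<close>, \<open>j\<close> is \<open>x {i, j}\<close>. Solutions are extensional
  functions on the set of pairs, so two solutions are equal iff they agree on every pair; this
  matters because covers are sets of solutions whose cardinality is taken.
\<close>

definition lp_feasible :: "'a set \<Rightarrow> ('a set \<Rightarrow> real) \<Rightarrow> bool" where
  "lp_feasible V x \<longleftrightarrow>
     x \<in> extensional (nsets V 2) \<and>
     (\<forall>i\<in>V. \<forall>j\<in>V. \<forall>k\<in>V. i \<noteq> j \<and> i \<noteq> k \<and> j \<noteq> k \<longrightarrow> x {i, j} \<le> x {i, k} + x {j, k}) \<and>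
     (\<forall>p\<in>nsets V 2. 0 \<le> x p \<and> x p \<le> 1)"

definition lp_value :: "'a set \<Rightarrow> 'a set set \<Rightarrow> real \<Rightarrow> ('a set \<Rightarrow> real) \<Rightarrow> real" where
  "lp_value V E lam x = (\<Sum>e\<in>E. x e) + (\<Sum>p\<in>nsets V 2. lam * (1 - x p))"

definition lp_optimal :: "'a set \<Rightarrow> 'a set set \<Rightarrow> real \<Rightarrow> ('a set \<Rightarrow> real) \<Rightarrow> bool" where
  "lp_optimal V E lam x \<longleftrightarrow> is_arg_min (lp_value V E lam) (lp_feasible V) x"

definition lp_opt :: "'a set \<Rightarrow> 'a set set \<Rightarrow> real \<Rightarrow> real" where
  "lp_opt V E lam = (INF x\<in>{x. lp_feasible V x}. lp_value V E lam x)"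

definition lp_approx :: "'a set \<Rightarrow> 'a set set \<Rightarrow> real \<Rightarrow> real \<Rightarrow> ('a set \<Rightarrow> real) \<Rightarrow> bool" where
  "lp_approx V E eps lam x \<longleftrightarrow>
     lp_feasible V x \<and> lp_value V E lam x \<le> (1 + eps) * lp_opt V E lam"

text \<open>
  \<open>is_lambda_plus V E eps lam0 x m\<close>: \<open>m\<close> is the largest parameter \<open>lam \<ge> lam0\<close> at which \<open>x\<close> is
  \<open>(1 + eps)\<close>-approximate. If \<open>x\<close> is approximate at arbitrarily large parameters (which happens for
  the all-ones solution, for instance on the edgeless graph), then \<open>m = \<infinity>\<close>.
\<close>

definition is_lambda_plus ::
    "'a set \<Rightarrow> 'a set set \<Rightarrow> real \<Rightarrow> real \<Rightarrow> ('a set \<Rightarrow> real) \<Rightarrow> ereal \<Rightarrow> bool" where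
  "is_lambda_plus V E eps lam0 x m \<longleftrightarrow>
     (let S = {lam. lam0 \<le> lam \<and> lp_approx V E eps lam x}
      in if bdd_above S then (\<exists>r\<in>S. (\<forall>s\<in>S. s \<le> r) \<and> m = ereal r) else m = \<infinity>)"

text \<open>
  \<open>fe_state V E eps C lam0 lamp\<close>: some execution reaches the head of the while loop with current
  set \<open>C\<close> and current values \<open>lam0\<close>, \<open>lamp\<close> of the two parameters, where \<open>lamp\<close> is \<open>None\<close> as long
  as the loop body has not been executed. The optimal solution is chosen nondeterministically.
\<close>

inductive fe_state ::
    "'a set \<Rightarrow> 'a set set \<Rightarrow> real \<Rightarrow> ('a set \<Rightarrow> real) set \<Rightarrow> ereal \<Rightarrow> ereal option \<Rightarrow> bool"
  for V :: "'a set" and E :: "'a set set" and eps :: real where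
  init: "fe_state V E eps {} (ereal (4 / (real (card V))\<^sup>2)) None"
| step: "fe_state V E eps (insert x C) (ereal (1 + eps) * lamp') (Some lamp')"
  if "fe_state V E eps C (ereal lam0) lamp" and "lam0 < 1"
    and "lp_optimal V E lam0 x" and "is_lambda_plus V E eps lam0 x lamp'"

text \<open>
  If the loop body is never executed (\<open>card V = 2\<close>), no final solution is added.
\<close>

inductive fe_cover :: "'a set \<Rightarrow> 'a set set \<Rightarrow> real \<Rightarrow> ('a set \<Rightarrow> real) set \<Rightarrow> bool"
  for V :: "'a set" and E :: "'a set set" and eps :: real where
  no_final: "fe_cover V E eps C"
  if "fe_state V E eps C lam0 lamp" and "\<not> lam0 < 1" and "\<forall>l. lamp = Some l \<longrightarrow> \<not> l < 1"
| final: "fe_cover V E eps (insert x C)"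
  if "fe_state V E eps C lam0 (Some (ereal l))" and "\<not> lam0 < 1" and "l < 1"
    and "lp_optimal V E l x"

lemma fe_state_finite: "fe_state V E eps C lam0 lamp \<Longrightarrow> finite C"
  by (induction rule: fe_state.induct) auto

lemma fe_cover_finite: "fe_cover V E eps C \<Longrightarrow> finite C"
  by (auto elim!: fe_cover.cases dest: fe_state_finite)

end

theory Submission
  imports Defs
begin

text \<open>
  Write \<open>q = 1 + eps\<close> and \<open>n = card V\<close>. The value of a fixed solution is affine in the parameter with
  nonnegative constant term, and the optimum is nondecreasing, so a solution that is optimal at
  \<open>lam\<close> is still approximate at \<open>q * lam\<close>. Hence each iteration multiplies the parameter by at least
  \<open>q\<^sup>2\<close>. If \<open>q \<le> 4\<close>, starting from \<open>4 / n\<^sup>2\<close>, this gives \<open>lam\<^sub>+ \<ge> q^(2 * k) / n\<^sup>2\<close> after \<open>k\<close> iterations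
  (unless \<open>lam\<^sub>+ \<ge> 1\<close>), which is what the bound needs when a final solution is added.

  For \<open>q > 4\<close> the first iteration has to be examined more closely: its solution must be shown to be
  approximate up to \<open>lam = min 1 (q\<^sup>2 / n\<^sup>2)\<close>. At every \<open>lam \<ge> 4 / n\<^sup>2\<close> it costs at most \<open>lam * P\<close>, where
  \<open>P\<close> is the number of connected pairs, so it suffices that the optimum is at least \<open>lam * P / q\<close>.
  This is shown separately on every component \<open>K\<close>. With \<open>a\<close> the total length of its edges, \<open>K\<close> has
  a closed tour of length at most \<open>2 * a\<close>; adding up, over the pairs at distance at most \<open>r\<close>
  along the tour, the triangle inequalities gives
  \<open>card K * r \<le> b + r * (r + 1) * a\<close> with \<open>b\<close> the sum of \<open>1 - x p\<close> over the pairs in \<open>K\<close>, and \<open>r\<close> is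
  chosen about \<open>card K / (2 * q)\<close>. If \<open>card K \<le> 2 * q\<close>, counting the edges of \<open>K\<close> is enough.
\<close>

section \<open>Tours in a connected set of nodes\<close>

text \<open>
  A solution is turned into a semimetric by giving the singleton \<open>{u} = {u, u}\<close> the value 0.
\<close>

definition pair_semimetric :: "'a set \<Rightarrow> ('a set \<Rightarrow> real) \<Rightarrow> bool" where
  "pair_semimetric V y \<longleftrightarrow>
     (\<forall>u\<in>V. y {u} = 0) \<and> (\<forall>u\<in>V. \<forall>v\<in>V. 0 \<le> y {u, v} \<and> y {u, v} \<le> 1) \<and>
     (\<forall>u\<in>V. \<forall>v\<in>V. \<forall>w\<in>V. y {u, w} \<le> y {u, v} + y {v, w})"

lemma pair_semimetric_subset: "pair_semimetric V y \<Longrightarrow> K \<subseteq> V \<Longrightarrow> pair_semimetric K y"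
  unfolding pair_semimetric_def by (meson subsetD)

lemma pair_semimetric_bounds:
  assumes "pair_semimetric V y" and "p \<in> nsets V 2"
  shows "0 \<le> y p" and "y p \<le> 1"
  using assms unfolding pair_semimetric_def nsets_2_eq by auto

fun walk_length :: "('a set \<Rightarrow> real) \<Rightarrow> 'a list \<Rightarrow> real" where
  "walk_length y (u # v # us) = y {u, v} + walk_length y (v # us)"
| "walk_length y _ = 0"

definition tour_length :: "('a set \<Rightarrow> real) \<Rightarrow> 'a list \<Rightarrow> real" where
  "tour_length y us = walk_length y (us @ [hd us])"

lemma walk_length_append:
  "walk_length y (us @ v # ws) = walk_length y (us @ [v]) + walk_length y (v # ws)"
  by (induction y "us @ [v]" arbitrary: us rule: walk_length.induct)
    (auto simp: Cons_eq_append_conv append_eq_Cons_conv)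

lemma walk_length_conv_sum:
  "walk_length y us = (\<Sum>i<length us - 1. y {us ! i, us ! Suc i})"
  by (induction y us rule: walk_length.induct)
    (auto simp: sum.lessThan_Suc_shift simp del: sum.lessThan_Suc)

lemma tour_length_conv_sum:
  assumes "us \<noteq> []"
  shows "tour_length y us = (\<Sum>i<length us. y {us ! i, us ! (Suc i mod length us)})"
proof -
  have "(us @ [hd us]) ! Suc i = us ! (Suc i mod length us)" if "i < length us" for i
    using that assms by (cases "Suc i = length us") (auto simp: nth_append hd_conv_nth)
  then show ?thesis
    by (auto simp: tour_length_def walk_length_conv_sum nth_append intro!: sum.cong)
qed

text \<open>The step from \<open>v\<close> to its successor becomes a detour over \<open>w\<close>;
  the way from \<open>w\<close> onwards is at most the way back to \<open>v\<close> plus the old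
  step, so \<open>{v, w}\<close> is paid twice.\<close>

lemma tour_length_insert:
  assumes y: "pair_semimetric V y" and us: "set (us @ v # ws) \<subseteq> V" and w: "w \<in> V"
  shows "tour_length y (us @ v # w # ws) \<le> tour_length y (us @ v # ws) + 2 * y {v, w}"
proof -
  \<comment> \<open>\<open>z\<close> is the cyclic successor of \<open>v\<close>, the first node of
    the tour when \<open>ws\<close> is empty.\<close>
  obtain z zs where z: "ws @ [hd (us @ [v])] = z # zs"
    by (cases ws) auto
  have "z \<in> set (ws @ [hd (us @ [v])])"
    unfolding z by simp
  moreover have "hd (us @ [v]) \<in> set (us @ [v])"
    by (rule hd_in_set) simp
  ultimately have "z \<in> V"
    using us by auto
  have hd: "hd (us @ v # xs) = hd (us @ [v])" for xs
    by (cases us) auto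
  have *: "tour_length y (us @ v # xs) =
      walk_length y (us @ [v]) + walk_length y (v # xs @ [hd (us @ [v])])" for xs
    unfolding tour_length_def hd[of xs] using walk_length_append[of y us v "xs @ [hd (us @ [v])]"] by simp
  have "y {w, z} \<le> y {v, w} + y {v, z}"
    using y w \<open>z \<in> V\<close> us unfolding pair_semimetric_def
    by (metis insert_commute in_set_conv_decomp subsetD)
  then show ?thesis
    using *[of ws] *[of "w # ws"] z by simp
qed

lemma sum_shift_mod:
  fixes g :: "nat \<Rightarrow> real"
  shows "(\<Sum>i<m. g ((i + j) mod m)) = (\<Sum>i<m. g i)"
proof (induction j)
  case (Suc j)
  have "(\<Sum>i<m. h (Suc i mod m)) = (\<Sum>i<m. h i)" for h :: "nat \<Rightarrow> real"
  proof (cases m)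
    case (Suc k)
    have "(\<Sum>i<k. h (Suc i mod Suc k)) = (\<Sum>i<k. h (Suc i))"
      by (intro sum.cong) auto
    then show ?thesis
      using Suc sum.lessThan_Suc_shift[of h k] by simp
  qed simp
  from this[of "\<lambda>i. g ((i + j) mod m)"] show ?case
    using Suc.IH by (simp add: mod_add_left_eq)
qed simp

text \<open>A hop over \<open>j\<close> positions is at most the sum of \<open>j\<close> consecutive
  tour steps. Over all starting points, each of these \<open>j\<close> steps runs once through the
  whole tour.\<close>

lemma sum_tour_steps_le:
  assumes y: "pair_semimetric V y" and us: "set us \<subseteq> V" "us \<noteq> []"
  shows "(\<Sum>i<length us. y {us ! i, us ! ((i + j) mod length us)}) \<le> real j * tour_length y us"
proof (induction j)
  case 0
  have "us ! i \<in> V" if "i < length us" for i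
    using that us by auto
  then show ?case
    using y by (auto simp: pair_semimetric_def intro!: sum_nonpos)
next
  case (Suc j)
  let ?m = "length us"
  let ?s = "\<lambda>i. us ! (i mod ?m)"
  have s: "?s i \<in> V" for i
    using us by (simp add: subset_code(1))
  have "(\<Sum>i<?m. y {us ! i, ?s (i + Suc j)})
      \<le> (\<Sum>i<?m. y {us ! i, ?s (i + j)} + y {?s (i + j), ?s (i + Suc j)})"
    using y s[of "_ + _"] us unfolding pair_semimetric_def
    by (intro sum_mono) (metis lessThan_iff nth_mem s subsetD)
  also have "\<dots> = (\<Sum>i<?m. y {us ! i, ?s (i + j)}) + (\<Sum>i<?m. y {?s (i + j), ?s (i + Suc j)})"
    by (rule sum.distrib)
  also have "(\<Sum>i<?m. y {?s (i + j), ?s (i + Suc j)}) = tour_length y us"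
    unfolding tour_length_conv_sum[OF us(2)]
    using sum_shift_mod[of "\<lambda>i. y {us ! i, us ! (Suc i mod ?m)}" j ?m]
    by (simp add: mod_Suc_eq)
  finally show ?case
    using Suc.IH by (simp add: algebra_simps)
qed

text \<open>
  Counting only the pairs at cyclic distance at most \<open>r\<close> on the tour; since \<open>2 * r < card K\<close>,
  no pair is counted twice.
\<close>

lemma tour_band_bound:
  assumes y: "pair_semimetric (set us) y" and us: "distinct us" and r: "2 * r < length us"
  shows "real (length us) * r
    \<le> (\<Sum>p\<in>nsets (set us) 2. 1 - y p) + real r * (real r + 1) / 2 * tour_length y us"
proof -
  let ?m = "length us"
  let ?f = "\<lambda>(j, i). {us ! i, us ! ((i + j) mod ?m)}"
  have ne: "us \<noteq> []" and m0: "?m > 0"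
    using r by auto
  have mod: "(i + j) mod ?m = i + j \<or> (i + j) mod ?m + ?m = i + j" "(i + j) mod ?m < ?m"
    if "i < ?m" "j \<le> r" for i j
    using that r by (cases "i + j < ?m"; simp add: le_mod_geq)+
  have inj: "inj_on ?f ({1..r} \<times> {..<?m})"
  proof (rule inj_onI, clarsimp)
    fix j i j' i'
    assume j: "Suc 0 \<le> j" "j \<le> r" "Suc 0 \<le> j'" "j' \<le> r" and i: "i < ?m" "i' < ?m"
      and eq: "{us ! i, us ! ((i + j) mod ?m)} = {us ! i', us ! ((i' + j') mod ?m)}"
    define a b where "a = (i + j) mod ?m" and "b = (i' + j') mod ?m"
    have ab: "a = i + j \<or> a + ?m = i + j" "a < ?m" "b = i' + j' \<or> b + ?m = i' + j'" "b < ?m"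
      unfolding a_def b_def using mod i j by auto
    have "i = i' \<and> a = b \<or> i = b \<and> i' = a"
      using eq us i ab(2,4) by (auto simp: doubleton_eq_iff nth_eq_iff_index_eq simp flip: a_def b_def)
    \<comment> \<open>With endpoints swapped, \<open>j + j'\<close> would be a positive multiple of
      \<open>?m\<close>, but it is at most \<open>2 * r\<close>.\<close>
    then show "j = j' \<and> i = i'"
      using ab i j r by - (elim disjE conjE; intro conjI; linarith)
  qed
  have sub: "?f ` ({1..r} \<times> {..<?m}) \<subseteq> nsets (set us) 2"
  proof clarsimp
    fix j i assume j: "Suc 0 \<le> j" "j \<le> r" and i: "i < ?m"
    have "(i + j) mod ?m < ?m" "(i + j) mod ?m \<noteq> i"
      using mod[OF i j(2)] i j r by linarith+
    then show "us ! ((i + j) mod ?m) \<in> set us \<and> us ! i \<noteq> us ! ((i + j) mod ?m)"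
      using us i by (auto simp: nth_eq_iff_index_eq)
  qed
  have "real ?m * r - real r * (real r + 1) / 2 * tour_length y us
      = (\<Sum>j=1..r. real ?m - j * tour_length y us)"
    by (induction r) (auto simp: field_simps)
  also have "\<dots> \<le> (\<Sum>j=1..r. \<Sum>i<?m. 1 - y {us ! i, us ! ((i + j) mod ?m)})"
    using sum_tour_steps_le[OF y order_refl ne] by (intro sum_mono) (simp add: sum_subtractf)
  also have "\<dots> = (\<Sum>q\<in>{1..r} \<times> {..<?m}. 1 - y (?f q))"
    by (simp add: sum.cartesian_product case_prod_unfold)
  also have "\<dots> = (\<Sum>p\<in>?f ` ({1..r} \<times> {..<?m}). 1 - y p)"
    by (subst sum.reindex[OF inj]) simp
  also have "\<dots> \<le> (\<Sum>p\<in>nsets (set us) 2. 1 - y p)"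
    using sub pair_semimetric_bounds[OF y] by (intro sum_mono2) (auto simp: finite_imp_finite_nsets)
  finally show ?thesis
    by simp
qed

section \<open>Connected components\<close>

definition component :: "'a set set \<Rightarrow> 'a \<Rightarrow> 'a set" where
  "component E v = {(u, w). {u, w} \<in> E}\<^sup>* `` {v}"

lemma component_self: "v \<in> component E v"
  by (simp add: component_def)

lemma component_eq: "u \<in> component E v \<Longrightarrow> component E u = component E v"
proof -
  have "sym ({(u, w). {u, w} \<in> E}\<^sup>*)"
    by (rule sym_rtrancl) (auto simp: sym_def insert_commute)
  then show "u \<in> component E v \<Longrightarrow> component E u = component E v"
    unfolding component_def by (auto dest: symD intro: rtrancl_trans)
qed

lemma component_edge: "{u, w} \<in> E \<Longrightarrow> component E u = component E w"
  by (rule component_eq[symmetric]) (auto simp: component_def)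

lemma component_subset:
  assumes "simple_graph V E" and "v \<in> V"
  shows "component E v \<subseteq> V"
proof -
  have "{(u, w). {u, w} \<in> E} `` V \<subseteq> V"
    using assms by (auto simp: simple_graph_def dest!: subsetD)
  from Image_closed_trancl[OF this] show ?thesis
    using assms(2) unfolding component_def by blast
qed

text \<open>If no edge left \<open>S\<close>, then \<open>S\<close> would be closed under adjacency
  and, containing \<open>v\<close>, contain the whole component.\<close>

lemma component_exit:
  assumes "S \<subset> component E v" and "v \<in> S"
  obtains u w where "u \<in> S" "w \<in> component E v - S" "{u, w} \<in> E"
proof -
  have "\<not> {(u, w). {u, w} \<in> E} `` S \<subseteq> S"
    using Image_closed_trancl[of "{(u, w). {u, w} \<in> E}" S] assms unfolding component_def by blast
  then obtain u w where uw: "u \<in> S" "w \<notin> S" "{u, w} \<in> E"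
    by auto
  moreover have "w \<in> component E v"
    using uw assms component_eq[of u E v] component_edge[OF uw(3)] component_self[of w E] by auto
  ultimately show thesis
    using that by blast
qed

text \<open>
  A connected set is explored node by node; each new node is inserted in the tour right after a
  neighbour.
\<close>

lemma component_tour:
  assumes G: "simple_graph V E" and v: "v \<in> V" and y: "pair_semimetric V y"
  obtains us where "distinct us" "set us = component E v"
    "card (component E v) \<le> Suc (card (E \<inter> nsets (component E v) 2))"
    "tour_length y us \<le> 2 * (\<Sum>e\<in>E \<inter> nsets (component E v) 2. y e)"
proof -
  let ?K = "component E v"
  have fin: "finite ?K" and KV: "?K \<subseteq> V"
    using component_subset[OF G v] G by (auto simp: simple_graph_def intro: finite_subset)
  \<comment> \<open>Each new node brings a new edge, which raises the edge count by one and pays for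
    the growth of the tour by at most twice its length.\<close>
  have "\<exists>us. distinct us \<and> v \<in> set us \<and> set us \<subseteq> ?K \<and> length us = Suc k \<and>
      k \<le> card (E \<inter> nsets (set us) 2) \<and>
      tour_length y us \<le> 2 * (\<Sum>e\<in>E \<inter> nsets (set us) 2. y e)" if "k < card ?K" for k
    using that
  proof (induction k)
    case 0
    have "nsets {v} 2 = {}"
      by (auto simp: nsets_2_eq)
    then show ?case
      using y v component_self[of v E]
      by (intro exI[of _ "[v]"]) (auto simp: tour_length_def pair_semimetric_def)
  next
    case (Suc k)
    then obtain us where us: "distinct us" "v \<in> set us" "set us \<subseteq> ?K" "length us = Suc k"
        "k \<le> card (E \<inter> nsets (set us) 2)"
        "tour_length y us \<le> 2 * (\<Sum>e\<in>E \<inter> nsets (set us) 2. y e)"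
      by auto
    have "set us \<noteq> ?K"
      using us(1,4) Suc.prems by (auto dest: distinct_card)
    then obtain u w where uw: "u \<in> set us" "w \<in> ?K - set us" "{u, w} \<in> E"
      using component_exit us(2,3) by (metis psubsetI)
    then obtain as bs where us_eq: "us = as @ u # bs"
      by (meson split_list)
    define ws where "ws = as @ u # w # bs"
    have set_ws: "set ws = insert w (set us)"
      by (auto simp: ws_def us_eq)
    have fin_ws: "finite (E \<inter> nsets (set ws) 2)"
      by (simp add: finite_imp_finite_nsets)
    have new: "insert {u, w} (E \<inter> nsets (set us) 2) \<subseteq> E \<inter> nsets (set ws) 2"
      using uw set_ws nsets_mono[of "set us" "set ws" 2] by auto
    have notin: "{u, w} \<notin> E \<inter> nsets (set us) 2"
      using uw by auto
    have "card (insert {u, w} (E \<inter> nsets (set us) 2)) \<le> card (E \<inter> nsets (set ws) 2)"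
      by (rule card_mono[OF fin_ws new])
    then have c: "Suc k \<le> card (E \<inter> nsets (set ws) 2)"
      using us(5) notin by (simp add: finite_imp_finite_nsets)
    have wsV: "set ws \<subseteq> V"
      using set_ws us(3) uw KV by auto
    have "tour_length y ws \<le> tour_length y us + 2 * y {u, w}"
      unfolding ws_def us_eq
      using tour_length_insert[OF y, of as u bs w] us(3) uw KV by (auto simp: us_eq)
    also have "\<dots> \<le> 2 * (\<Sum>e\<in>insert {u, w} (E \<inter> nsets (set us) 2). y e)"
      using us(6) notin by (simp add: finite_imp_finite_nsets)
    also have "\<dots> \<le> 2 * (\<Sum>e\<in>E \<inter> nsets (set ws) 2. y e)"
      using pair_semimetric_bounds[OF pair_semimetric_subset[OF y wsV]] new fin_ws
      by (intro mult_left_mono sum_mono2) auto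
    finally show ?case
      using us uw set_ws c by (intro exI[of _ ws]) (auto simp: ws_def us_eq)
  qed
  from this[of "card ?K - 1"] obtain us where us: "distinct us" "set us \<subseteq> ?K"
      "length us = Suc (card ?K - 1)" "card ?K - 1 \<le> card (E \<inter> nsets (set us) 2)"
      "tour_length y us \<le> 2 * (\<Sum>e\<in>E \<inter> nsets (set us) 2. y e)"
    using fin component_self[of v E] by (metis card_gt_0_iff diff_less empty_iff zero_less_one)
  have pos: "card ?K > 0"
    using fin component_self[of v E] by (auto simp: card_gt_0_iff)
  then have "set us = ?K"
    using us fin by (intro card_subset_eq) (auto simp: distinct_card)
  then show thesis
    using us that by auto
qed

section \<open>The optimum of the relaxation\<close>

definition inner_pairs :: "'a set \<Rightarrow> 'a set set \<Rightarrow> 'a set set" where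
  "inner_pairs V E = (\<Union>K\<in>component E ` V. nsets K 2)"

lemma inner_pairs_iff:
  assumes G: "simple_graph V E"
  shows "{u, w} \<in> inner_pairs V E \<longleftrightarrow>
    u \<in> V \<and> w \<in> V \<and> u \<noteq> w \<and> component E u = component E w"
proof
  assume "{u, w} \<in> inner_pairs V E"
  then obtain v where v: "v \<in> V" and uw: "u \<in> component E v" "w \<in> component E v" "u \<noteq> w"
    by (auto simp: inner_pairs_def)
  then show "u \<in> V \<and> w \<in> V \<and> u \<noteq> w \<and> component E u = component E w"
    using component_subset[OF G v] component_eq[of u E v] component_eq[of w E v] by auto
next
  assume "u \<in> V \<and> w \<in> V \<and> u \<noteq> w \<and> component E u = component E w"
  then show "{u, w} \<in> inner_pairs V E"
    using component_self[of u E] component_self[of w E] by (auto simp: inner_pairs_def)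
qed

lemma inner_pairs_subset:
  assumes "simple_graph V E"
  shows "inner_pairs V E \<subseteq> nsets V 2"
  using nsets_mono[OF component_subset[OF assms]] by (auto simp: inner_pairs_def)

lemma edges_subset_inner_pairs:
  assumes G: "simple_graph V E"
  shows "E \<subseteq> inner_pairs V E"
proof
  fix e assume e: "e \<in> E"
  then have "e \<in> nsets V 2"
    using G by (auto simp: simple_graph_def)
  then obtain u w where "e = {u, w}" "u \<in> V" "w \<in> V" "u \<noteq> w"
    by (rule nsets2_E) (auto simp: nsets_def)
  then show "e \<in> inner_pairs V E"
    using e component_edge[of u w E] inner_pairs_iff[OF G] by auto
qed

text \<open>Distinct components are disjoint, so no pair lies inside two of them. \<open>F\<close>
  is \<open>E\<close> when edges are summed and \<open>UNIV\<close> when all pairs are.\<close>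

lemma sum_components:
  fixes g :: "'a set \<Rightarrow> real"
  assumes G: "simple_graph V E"
  shows "(\<Sum>K\<in>component E ` V. \<Sum>p\<in>F \<inter> nsets K 2. g p) = (\<Sum>p\<in>F \<inter> inner_pairs V E. g p)"
proof -
  have fin: "finite V"
    using G by (simp add: simple_graph_def)
  have disj: "(F \<inter> nsets K 2) \<inter> (F \<inter> nsets L 2) = {}"
    if "K \<in> component E ` V" "L \<in> component E ` V" "K \<noteq> L" for K L
  proof -
    have "K \<inter> L = {}"
      using that component_eq[of _ E] by blast
    then show ?thesis
      by (fastforce simp: nsets_2_eq doubleton_eq_iff)
  qed
  have "finite (nsets K 2)" if "K \<in> component E ` V" for K
    using that component_subset[OF G] fin
    by (auto intro!: finite_imp_finite_nsets intro: finite_subset)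
  then have "(\<Sum>p\<in>(\<Union>K\<in>component E ` V. F \<inter> nsets K 2). g p)
      = (\<Sum>K\<in>component E ` V. \<Sum>p\<in>F \<inter> nsets K 2. g p)"
    using fin disj by (intro sum.UNION_disjoint) auto
  then show ?thesis
    by (simp add: inner_pairs_def)
qed

text \<open>The right-hand side is the share of one component in the value of a solution; the
  left-hand side is \<open>1 / q\<close> times this share when all its nodes have distance
  0.\<close>

lemma component_cost:
  assumes G: "simple_graph V E" and v: "v \<in> V" and y: "pair_semimetric V y" and q: "q > 4"
    and lam: "lam = min 1 (q\<^sup>2 / (real (card V))\<^sup>2)"
  shows "lam / q * card (nsets (component E v) 2) \<le>
    (\<Sum>e\<in>E \<inter> nsets (component E v) 2. y e) + lam * (\<Sum>p\<in>nsets (component E v) 2. 1 - y p)"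
proof -
  define K m n where "K = component E v" and "m = real (card K)" and "n = real (card V)"
  define a b where "a = (\<Sum>e\<in>E \<inter> nsets K 2. y e)" and "b = (\<Sum>p\<in>nsets K 2. 1 - y p)"
  obtain us where us: "distinct us" "set us = K" "card K \<le> Suc (card (E \<inter> nsets K 2))"
      "tour_length y us \<le> 2 * a"
    using component_tour[OF G v y] unfolding K_def a_def by blast
  have finV: "finite V" and KV: "K \<subseteq> V"
    using G component_subset[OF G v] by (auto simp: simple_graph_def K_def)
  have fin: "finite K"
    using finV KV by (rule rev_finite_subset)
  have fin2: "finite (nsets K 2)"
    using fin by (rule finite_imp_finite_nsets)
  have yK: "pair_semimetric K y"
    using y KV by (rule pair_semimetric_subset)
  note y01 = pair_semimetric_bounds[OF yK]
  have m1: "1 \<le> m"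
    using fin component_self[of v E] by (auto simp: m_def K_def Suc_le_eq card_gt_0_iff)
  have mn: "m \<le> n"
    using card_mono[OF finV KV] by (simp add: m_def n_def)
  have lam01: "0 < lam" "lam \<le> 1"
    using lam q m1 mn by (auto simp: n_def)
  have a0: "0 \<le> a"
    unfolding a_def using y01(1) by (intro sum_nonneg) auto
  have b0: "0 \<le> b"
    unfolding b_def using y01(2) by (intro sum_nonneg) auto
  have pairs: "real (card (nsets K 2)) = m * (m - 1) / 2"
    using m1 by (simp add: m_def choose_two real_of_nat_div of_nat_diff)
  have "lam / q * (m * (m - 1) / 2) \<le> a + lam * b"
  proof (cases "m \<le> 2 * q")
    case True
    \<comment> \<open>Each edge contributes \<open>y e + (1 - y e) = 1\<close>, and a connected set
      has at least \<open>m - 1\<close> edges.\<close>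
    have "m - 1 \<le> card (E \<inter> nsets K 2)"
      using us(3) by (simp add: m_def)
    also have "\<dots> = a + (\<Sum>e\<in>E \<inter> nsets K 2. 1 - y e)"
      by (simp add: a_def sum_subtractf)
    also have "(\<Sum>e\<in>E \<inter> nsets K 2. 1 - y e) \<le> b"
      unfolding b_def using y01(2) fin2 by (intro sum_mono2) auto
    finally have *: "m - 1 \<le> a + b"
      by simp
    have "lam / q * (m * (m - 1) / 2) = lam * (m - 1) * (m / (2 * q))"
      by (simp add: mult_ac)
    also have "\<dots> \<le> lam * (m - 1) * 1"
      using True q m1 lam01 by (intro mult_left_mono) auto
    also have "\<dots> \<le> lam * (a + b)"
      using * lam01 by simp
    also have "\<dots> \<le> a + lam * b"
      using lam01 a0 mult_right_mono[of lam 1 a] by (simp add: distrib_left)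
    finally show ?thesis .
  next
    case False
    then have big: "2 * q < m"
      by simp
    have lamq: "lam = q\<^sup>2 / n\<^sup>2"
    proof -
      have "q\<^sup>2 \<le> n\<^sup>2"
        using big mn q by (intro power_mono) auto
      then show ?thesis
        unfolding lam n_def[symmetric] using m1 mn by (simp add: min_def)
    qed
    \<comment> \<open>Rounding up makes \<open>lam * m * r\<close> at least the left-hand side of
      the goal; as \<open>q > 4\<close> and \<open>m > 2 * q\<close>, still
      \<open>2 * r < m\<close>.\<close>
    define r where "r = nat \<lceil>(m - 1) / (2 * q)\<rceil>"
    have r: "(m - 1) / (2 * q) \<le> r" "r < (m - 1) / (2 * q) + 1"
      unfolding r_def using m1 q by (linarith | simp)+
    have rq: "m - 1 \<le> 2 * q * r" "2 * q * r < m - 1 + 2 * q"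
      using r q by (simp_all add: field_simps)
    have r1: "1 \<le> real r"
    proof -
      have "r \<noteq> 0"
        using rq(1) big q by (intro notI) auto
      then show ?thesis
        by simp
    qed
    have "8 * real r \<le> 2 * q * r"
      using q by (intro mult_right_mono) auto
    then have "2 * real r < m"
      using rq(2) big q by linarith
    then have "2 * r < length us"
      using us(1,2) by (simp add: m_def flip: distinct_card)
    then have "m * r \<le> b + real r * (real r + 1) / 2 * tour_length y us"
      using tour_band_bound[of us y] us(1,2) yK by (simp add: m_def b_def flip: distinct_card)
    also have "\<dots> \<le> b + real r * (real r + 1) / 2 * (2 * a)"
      using us(4) by (intro add_left_mono mult_left_mono) auto
    finally have band: "m * r \<le> b + real r * (real r + 1) * a"
      by simp
    show ?thesis
    proof (cases "lam * (real r * (real r + 1)) \<le> 1")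
      case True
      \<comment> \<open>The band inequality is multiplied by \<open>lam\<close>, which leaves
        \<open>a\<close> with a coefficient of at most 1.\<close>
      have "lam / q * (m * (m - 1) / 2) = lam * m * ((m - 1) / (2 * q))"
        by (simp add: mult_ac)
      also have "\<dots> \<le> lam * m * r"
        using r lam01 m1 by (intro mult_left_mono) auto
      also have "\<dots> \<le> lam * (b + real r * (real r + 1) * a)"
        using band lam01 by simp
      also have "\<dots> \<le> a + lam * b"
        using True a0 mult_right_mono[OF True a0] by (simp add: algebra_simps)
      finally show ?thesis .
    next
      case False
      \<comment> \<open>Now the band inequality is divided by \<open>?R\<close>, and
        \<open>1 / ?R < lam\<close> handles \<open>b\<close>. It remains to show that the left-hand
        side is at most \<open>m / (real r + 1)\<close>.\<close>
      let ?R = "real r * (real r + 1)"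
      have R: "0 < ?R"
        using r1 by simp
      have "q * ((real r + 1) * (m - 1)) = (2 * q * r + 2 * q) * (m - 1) / 2"
        by (simp add: algebra_simps)
      \<comment> \<open>The first factor is less than \<open>m - 1 + 4 * q\<close>, hence less than
        \<open>3 * m\<close> by \<open>2 * q < m\<close>.\<close>
      also have "\<dots> \<le> (3 * m) * m / 2"
        using rq big m1 q by (intro divide_right_mono mult_mono) auto
      also have "\<dots> \<le> (3 * n) * n / 2"
        using mn m1 by (intro divide_right_mono mult_mono) auto
      also have "\<dots> \<le> 2 * n\<^sup>2"
        using m1 mn by (simp add: power2_eq_square)
      finally have "q * ((real r + 1) * (m - 1)) \<le> 2 * n\<^sup>2" .
      then have "q * (m - 1) / (2 * n\<^sup>2) \<le> 1 / (real r + 1)"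
        using m1 mn by (simp add: divide_simps) (simp add: algebra_simps)
      then have "m * (q * (m - 1) / (2 * n\<^sup>2)) \<le> m * (1 / (real r + 1))"
        using m1 by (intro mult_left_mono) auto
      then have "lam / q * (m * (m - 1) / 2) \<le> m / (real r + 1)"
        unfolding lamq using q by (simp add: power2_eq_square mult_ac)
      also have "\<dots> = m * r / ?R"
        using r1 by simp
      also have "\<dots> \<le> (b + ?R * a) / ?R"
        using band R by (intro divide_right_mono) auto
      also have "\<dots> = a + b / ?R"
        using R by (simp add: field_simps)
      also have "\<dots> \<le> a + lam * b"
      proof -
        have "1 / ?R \<le> lam"
          using False R by (simp add: divide_le_eq)
        from mult_right_mono[OF this b0] show ?thesis
          by simp
      qed
      finally show ?thesis .
    qed
  qed
  then show ?thesis
    unfolding pairs[symmetric] a_def b_def K_def .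
qed

section \<open>Bounds on values and on the optimum\<close>

lemma lp_value_mono:
  assumes "lp_feasible V x" and "lam \<le> lam'"
  shows "lp_value V E lam x \<le> lp_value V E lam' x"
  using assms unfolding lp_value_def lp_feasible_def
  by (intro add_left_mono sum_mono mult_right_mono) auto

text \<open>Scaling \<open>lam\<close> scales only the linear part of the value; the constant part
  is nonnegative, hence at most \<open>c\<close> times itself.\<close>

lemma lp_value_scale:
  assumes "simple_graph V E" and "lp_feasible V x" and "1 \<le> c"
  shows "lp_value V E (c * lam) x \<le> c * lp_value V E lam x"
proof -
  have "0 \<le> (\<Sum>e\<in>E. x e)"
    using assms unfolding lp_feasible_def simple_graph_def by (intro sum_nonneg) auto
  then have "(\<Sum>e\<in>E. x e) \<le> c * (\<Sum>e\<in>E. x e)"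
    using assms(3) mult_right_mono[of 1 c] by simp
  then show ?thesis
    by (simp add: lp_value_def distrib_left mult.assoc flip: sum_distrib_left)
qed

text \<open>Contracting every component cuts no edge, so the value has no constant part: this gives
  the upper bound that is proportional to \<open>lam\<close>.\<close>

definition component_solution :: "'a set \<Rightarrow> 'a set set \<Rightarrow> 'a set \<Rightarrow> real" where
  "component_solution V E = (\<lambda>p\<in>nsets V 2. if p \<in> inner_pairs V E then 0 else 1)"

lemma component_solution_feasible:
  assumes G: "simple_graph V E"
  shows "lp_feasible V (component_solution V E)"
  by (auto simp: lp_feasible_def component_solution_def inner_pairs_iff[OF G])

lemma lp_value_component_solution:
  assumes G: "simple_graph V E"
  shows "lp_value V E lam (component_solution V E) = lam * card (inner_pairs V E)"
proof -
  have "(\<Sum>e\<in>E. component_solution V E e) = 0"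
    using edges_subset_inner_pairs[OF G] inner_pairs_subset[OF G]
    by (intro sum.neutral) (auto simp: component_solution_def)
  moreover have "(\<Sum>p\<in>nsets V 2. lam * (1 - component_solution V E p))
      = (\<Sum>p\<in>inner_pairs V E. lam)"
    using G inner_pairs_subset[OF G]
    by (intro sum.mono_neutral_cong_right)
      (auto simp: component_solution_def simple_graph_def finite_imp_finite_nsets)
  ultimately show ?thesis
    by (simp add: lp_value_def)
qed

text \<open>An infimum of reals needs a nonempty set for this rule;
  \<open>component_solution\<close> is a feasible point.\<close>

lemma lp_opt_greatest:
  assumes "simple_graph V E" and "\<And>x. lp_feasible V x \<Longrightarrow> c \<le> lp_value V E lam x"
  shows "c \<le> lp_opt V E lam"
  unfolding lp_opt_def using assms component_solution_feasible[OF assms(1)]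
  by (intro cINF_greatest) auto

lemma lp_optimal_feasible: "lp_optimal V E lam x \<Longrightarrow> lp_feasible V x"
  by (simp add: lp_optimal_def is_arg_min_def)

lemma lp_optimal_le:
  "lp_optimal V E lam x \<Longrightarrow> lp_feasible V z \<Longrightarrow> lp_value V E lam x \<le> lp_value V E lam z"
  by (simp add: lp_optimal_def is_arg_min_linorder)

text \<open>Feasibility covers three distinct nodes; the value 0 on singletons settles the cases of
  coinciding nodes.\<close>

lemma pair_semimetric_feasible:
  assumes "lp_feasible V x"
  shows "pair_semimetric V (\<lambda>p. if p \<in> nsets V 2 then x p else 0)"
proof -
  have tri: "x {u, w} \<le> x {u, v} + x {v, w}"
    if "u \<in> V" "v \<in> V" "w \<in> V" "u \<noteq> v" "v \<noteq> w" "u \<noteq> w" for u v w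
  proof -
    have "x {u, w} \<le> x {u, v} + x {w, v}"
      using assms that unfolding lp_feasible_def by metis
    then show ?thesis
      by (simp add: insert_commute)
  qed
  have "{u} \<notin> nsets V 2" for u
    by (simp add: nsets_def)
  moreover have "0 \<le> x p" "x p \<le> 1" if "p \<in> nsets V 2" for p
    using assms that by (auto simp: lp_feasible_def)
  ultimately show ?thesis
    using tri unfolding pair_semimetric_def by (auto simp: insert_commute)
qed

text \<open>\<open>component_cost\<close> is summed over the components. All edges lie inside
  components, and pairs between components only add nonnegative terms.\<close>

lemma lp_opt_lower_bound:
  assumes G: "simple_graph V E" and q: "q > 4" and V: "V \<noteq> {}"
    and lam: "lam = min 1 (q\<^sup>2 / (real (card V))\<^sup>2)"
  shows "lam * card (inner_pairs V E) \<le> q * lp_opt V E lam"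
proof -
  have "lam / q * card (inner_pairs V E) \<le> lp_opt V E lam"
  proof (rule lp_opt_greatest[OF G])
    fix x assume x: "lp_feasible V x"
    let ?y = "\<lambda>p. if p \<in> nsets V 2 then x p else 0"
    let ?I = "inner_pairs V E"
    have lam0: "0 \<le> lam"
      using lam by simp
    have fin: "finite (nsets V 2)"
      using G by (simp add: simple_graph_def finite_imp_finite_nsets)
    have "lam / q * card ?I = (\<Sum>K\<in>component E ` V. \<Sum>p\<in>nsets K 2. lam / q)"
      using sum_components[OF G, where F = UNIV and g = "\<lambda>_. lam / q"] by simp
    also have "\<dots> \<le> (\<Sum>K\<in>component E ` V.
        (\<Sum>e\<in>E \<inter> nsets K 2. ?y e) + lam * (\<Sum>p\<in>nsets K 2. 1 - ?y p))"
      using component_cost[OF G _ pair_semimetric_feasible[OF x] q lam]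
      by (intro sum_mono) (auto simp: mult.commute)
    also have "\<dots> = (\<Sum>e\<in>E \<inter> ?I. ?y e) + lam * (\<Sum>p\<in>?I. 1 - ?y p)"
      using sum_components[OF G, where F = E] sum_components[OF G, where F = UNIV]
      by (simp add: sum.distrib flip: sum_distrib_left)
    also have "(\<Sum>e\<in>E \<inter> ?I. ?y e) = (\<Sum>e\<in>E. x e)"
      using edges_subset_inner_pairs[OF G] inner_pairs_subset[OF G] by (intro sum.cong) auto
    also have "(\<Sum>p\<in>?I. 1 - ?y p) \<le> (\<Sum>p\<in>nsets V 2. 1 - ?y p)"
      using inner_pairs_subset[OF G] fin x by (intro sum_mono2) (auto simp: lp_feasible_def)
    also have "(\<Sum>p\<in>nsets V 2. 1 - ?y p) = (\<Sum>p\<in>nsets V 2. 1 - x p)"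
      by (intro sum.cong) auto
    finally show "lam / q * card ?I \<le> lp_value V E lam x"
      using lam0 by (simp add: lp_value_def sum_distrib_left mult_left_mono)
  qed
  then show ?thesis
    using q by (simp add: field_simps)
qed

section \<open>Growth of the parameter\<close>

lemma lp_approx_scale:
  assumes G: "simple_graph V E" and eps: "0 < eps" and lam: "0 \<le> lam"
    and x: "lp_optimal V E lam x"
  shows "lp_approx V E eps ((1 + eps) * lam) x"
proof -
  have "lp_value V E lam x \<le> lp_opt V E ((1 + eps) * lam)"
  proof (rule lp_opt_greatest[OF G])
    fix z assume z: "lp_feasible V z"
    have "lp_value V E lam x \<le> lp_value V E lam z"
      using lp_optimal_le[OF x z] .
    also have "\<dots> \<le> lp_value V E ((1 + eps) * lam) z"
      using z eps lam by (intro lp_value_mono) (auto simp: distrib_right)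
    finally show "lp_value V E lam x \<le> lp_value V E ((1 + eps) * lam) z" .
  qed
  then have "(1 + eps) * lp_value V E lam x \<le> (1 + eps) * lp_opt V E ((1 + eps) * lam)"
    using eps by (intro mult_left_mono) auto
  with lp_value_scale[OF G lp_optimal_feasible[OF x], of "1 + eps" lam] eps
  have "lp_value V E ((1 + eps) * lam) x \<le> (1 + eps) * lp_opt V E ((1 + eps) * lam)"
    by linarith
  then show ?thesis
    using lp_optimal_feasible[OF x] by (simp add: lp_approx_def)
qed

text \<open>At the starting parameter, \<open>lp_approx_scale\<close> reaches only
  \<open>4 * q / n\<^sup>2\<close>, which falls short of \<open>q\<^sup>2 / n\<^sup>2\<close> once
  \<open>q > 4\<close>; the component bounds close this gap.\<close>

lemma lp_approx_initial:
  assumes G: "simple_graph V E" and n: "2 \<le> card V" and eps: "0 < eps"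
    and x: "lp_optimal V E (4 / (real (card V))\<^sup>2) x"
  obtains L where "4 / (real (card V))\<^sup>2 \<le> L" "min 1 ((1 + eps)\<^sup>2 / (real (card V))\<^sup>2) \<le> L"
    "lp_approx V E eps L x"
proof -
  define q t where "q = 1 + eps" and "t = 4 / (real (card V))\<^sup>2"
  have "2\<^sup>2 \<le> (real (card V))\<^sup>2"
    using n by (intro power_mono) auto
  then have t: "0 < t" "t \<le> 1"
    using n by (auto simp: t_def)
  show thesis
  proof (cases "q \<le> 4")
    case True
    have "q\<^sup>2 \<le> q * 4"
      using True eps unfolding power2_eq_square by (intro mult_left_mono) (auto simp: q_def)
    then have "q\<^sup>2 / (real (card V))\<^sup>2 \<le> q * t"
      unfolding t_def times_divide_eq_right by (intro divide_right_mono) auto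
    then have "min 1 (q\<^sup>2 / (real (card V))\<^sup>2) \<le> q * t"
      by (rule min.coboundedI2)
    moreover have "t \<le> q * t"
      using t eps by (simp add: q_def)
    ultimately show thesis
      using that lp_approx_scale[OF G eps _ x] t unfolding q_def t_def by auto
  next
    case False
    define L where "L = min 1 (q\<^sup>2 / (real (card V))\<^sup>2)"
    have "4 \<le> q\<^sup>2"
      using False power_mono[of 2 q 2] by simp
    then have tL: "t \<le> L"
      using t unfolding L_def t_def by (auto intro: divide_right_mono)
    \<comment> \<open>Optimality bounds the value at \<open>t\<close> by \<open>t\<close> times the
      number of connected pairs; scaling by \<open>L / t\<close> carries this bound to
      \<open>L\<close>.\<close>
    have "t * lp_value V E L x = t * lp_value V E (L / t * t) x"
      using t by simp
    also have "\<dots> \<le> t * (L / t * lp_value V E t x)"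
      using t tL lp_optimal_feasible[OF x] by (intro mult_left_mono lp_value_scale[OF G]) auto
    also have "\<dots> = L * lp_value V E t x"
      using t by simp
    also have "\<dots> \<le> L * (t * card (inner_pairs V E))"
    proof (rule mult_left_mono)
      show "lp_value V E t x \<le> t * card (inner_pairs V E)"
        using lp_optimal_le[OF x component_solution_feasible[OF G]]
        unfolding lp_value_component_solution[OF G] t_def .
    qed (use t tL in linarith)
    finally have "lp_value V E L x \<le> L * card (inner_pairs V E)"
      using t by simp
    also have "\<dots> \<le> q * lp_opt V E L"
      using False n by (intro lp_opt_lower_bound[OF G _ _ L_def]) auto
    finally show thesis
      using that[of L] tL lp_optimal_feasible[OF x] by (simp add: L_def q_def t_def lp_approx_def)
  qed
qed

lemma is_lambda_plus_ge:
  assumes "is_lambda_plus V E eps lam0 x m" and "lam0 \<le> L" and "lp_approx V E eps L x"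
  shows "ereal L \<le> m"
  using assms by (auto simp: is_lambda_plus_def Let_def split: if_splits)

text \<open>\<open>k\<close> stands for the number of iterations minus one; \<open>card C\<close> is
  only bounded, since solutions may repeat. For \<open>k > 0\<close>, the bound on
  \<open>(1 + eps) ^ k\<close> comes from the loop test passed by the last iteration.\<close>

lemma fe_state_bounds:
  assumes G: "simple_graph V E" and n: "2 \<le> card V" and eps: "0 < eps"
    and "fe_state V E eps C lam0 lamp"
  shows "(lamp = None \<longrightarrow> C = {} \<and> lam0 = ereal (4 / (real (card V))\<^sup>2)) \<and>
    (\<forall>l. lamp = Some l \<longrightarrow> lam0 = ereal (1 + eps) * l \<and>
      (\<exists>k. card C \<le> Suc k \<and> (1 + eps) ^ k < real (card V) \<and>
        ereal (min 1 (((1 + eps) ^ Suc k / real (card V))\<^sup>2)) \<le> l))"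
  using assms(4)
proof induction
  case init
  then show ?case
    by simp
next
  case (step C lam0 lamp x lamp')
  define n where "n = real (card V)"
  have n2: "2 \<le> n"
    using \<open>2 \<le> card V\<close> by (simp add: n_def)
  have q: "1 < 1 + eps"
    using eps by simp
  have "\<exists>k. card (insert x C) \<le> Suc k \<and> (1 + eps) ^ k < n \<and>
      ereal (min 1 (((1 + eps) ^ Suc k / n)\<^sup>2)) \<le> lamp'"
  proof (cases lamp)
    case None
    then have C: "C = {}" and lam0: "lam0 = 4 / n\<^sup>2"
      using step.IH by (auto simp: n_def)
    obtain L where L: "4 / n\<^sup>2 \<le> L" "min 1 ((1 + eps)\<^sup>2 / n\<^sup>2) \<le> L" "lp_approx V E eps L x"
      using lp_approx_initial[OF G \<open>2 \<le> card V\<close> eps, of x] step.hyps(3) lam0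
      by (auto simp: n_def)
    have "ereal L \<le> lamp'"
      using is_lambda_plus_ge[OF step.hyps(4)] L lam0 by simp
    then have "ereal (min 1 ((1 + eps)\<^sup>2 / n\<^sup>2)) \<le> lamp'"
      using L(2) order_trans ereal_less_eq(3) by blast
    then show ?thesis
      using C n2 by (intro exI[of _ 0]) (simp add: power_divide)
  next
    case (Some l)
    then obtain k where lam0: "ereal lam0 = ereal (1 + eps) * l"
      and k: "card C \<le> Suc k" "ereal (min 1 (((1 + eps) ^ Suc k / n)\<^sup>2)) \<le> l"
      using step.IH by (auto simp: n_def)
    \<comment> \<open>An infinite \<open>l\<close> would make the real \<open>lam0\<close>
      infinite.\<close>
    obtain r where r: "l = ereal r"
      using lam0 q by (cases l) auto
    have lam0r: "lam0 = (1 + eps) * r"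
      using lam0 r by simp
    have min_r: "min 1 (((1 + eps) ^ Suc k / n)\<^sup>2) \<le> r"
      using k(2) unfolding r ereal_less_eq(3) .
    then have r0: "0 \<le> r"
      by (smt (verit) zero_le_power2)
    have "r \<le> lam0"
      unfolding lam0r using eps r0 mult_right_mono[of 1 "1 + eps" r] by simp
    \<comment> \<open>The loop test gives \<open>r \<le> lam0 < 1\<close>, so the minimum is not
      1.\<close>
    then have r1: "((1 + eps) ^ Suc k / n)\<^sup>2 \<le> r" "r < 1"
      using min_r step.hyps(2) by auto
    then have "((1 + eps) ^ Suc k / n)\<^sup>2 < 1\<^sup>2"
      by simp
    then have "(1 + eps) ^ Suc k / n < 1"
      by (rule power_less_imp_less_base) simp
    then have kn: "(1 + eps) ^ Suc k < n"
      using n2 by simp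
    have lam00: "0 \<le> lam0"
      using \<open>r \<le> lam0\<close> r0 by simp
    have "lam0 \<le> (1 + eps) * lam0"
      using eps lam00 mult_right_mono[of 1 "1 + eps" lam0] by simp
    then have "ereal ((1 + eps) * lam0) \<le> lamp'"
      by (rule is_lambda_plus_ge[OF step.hyps(4) _ lp_approx_scale[OF G eps lam00 step.hyps(3)]])
    \<comment> \<open>One factor \<open>1 + eps\<close> comes from the update of
      \<open>lam0\<close>, the other from \<open>lp_approx_scale\<close>; inside the square they
      amount to one more power.\<close>
    moreover have "min 1 (((1 + eps) ^ Suc (Suc k) / n)\<^sup>2) \<le> (1 + eps) * lam0"
    proof -
      have "((1 + eps) ^ Suc (Suc k) / n)\<^sup>2 = (1 + eps)\<^sup>2 * ((1 + eps) ^ Suc k / n)\<^sup>2"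
        by (simp add: power2_eq_square)
      also have "\<dots> \<le> (1 + eps)\<^sup>2 * r"
        using r1 by (intro mult_left_mono) auto
      finally show ?thesis
        by (simp add: lam0r power2_eq_square)
    qed
    ultimately have "ereal (min 1 (((1 + eps) ^ Suc (Suc k) / n)\<^sup>2)) \<le> lamp'"
      using order_trans ereal_less_eq(3) by blast
    moreover have "card (insert x C) \<le> Suc (Suc k)"
      using k(1) card_insert_le_m1[of "Suc (Suc k)" C x] by simp
    ultimately show ?thesis
      using kn by blast
  qed
  then show ?case
    by (simp add: n_def)
qed

section \<open>Counting the solutions in a cover\<close>

theorem theorem11:
  fixes V :: "'a set" and E :: "'a set set" and eps :: real and C :: "('a set \<Rightarrow> real) set"
  assumes "simple_graph V E" and "card V \<ge> 2" and "eps > 0"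
    and "fe_cover V E eps C"
  shows "int (card C) \<le> \<lceil>log (1 + eps) (real (card V))\<rceil>"
proof -
  let ?n = "real (card V)"
  \<comment> \<open>The strict inequality \<open>k < log (1 + eps) ?n\<close> lifts the ceiling to
    \<open>k + 1\<close>, matching \<open>Suc k\<close> in the invariant.\<close>
  have less_ceiling: "int (Suc k) \<le> \<lceil>log (1 + eps) ?n\<rceil>" if "(1 + eps) ^ k < ?n" for k
  proof -
    have "real k < log (1 + eps) ?n"
      using that assms(2,3) by (simp add: less_log_iff powr_realpow)
    then show ?thesis
      by linarith
  qed
  \<comment> \<open>This serves the run that never enters the loop, where \<open>C\<close> is
    empty.\<close>
  have nonneg: "0 \<le> \<lceil>log (1 + eps) ?n\<rceil>"
    using assms(2) order_trans[OF of_nat_0_le_iff less_ceiling[of 0]] by simp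
  note bounds = fe_state_bounds[OF assms(1-3)]
  from assms(4) show ?thesis
  proof cases
    case (no_final lam0 lamp)
    show ?thesis
    proof (cases lamp)
      case None
      then show ?thesis
        using bounds[OF no_final(1)] nonneg by simp
    next
      case (Some l)
      then obtain k where "card C \<le> Suc k" "(1 + eps) ^ k < ?n"
        using bounds[OF no_final(1)] by auto
      then show ?thesis
        using less_ceiling[of k] by simp
    qed
  next
    case (final C' lam0 l x)
    then obtain k where k: "card C' \<le> Suc k"
        "ereal (min 1 (((1 + eps) ^ Suc k / ?n)\<^sup>2)) \<le> ereal l"
      using bounds[OF final(2)] by blast
    \<comment> \<open>Here \<open>l < 1\<close> rules out the minimum 1, so the power bound also
      holds for \<open>Suc k\<close>; the extra exponent pays for the final solution
      \<open>x\<close>.\<close>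
    have "((1 + eps) ^ Suc k / ?n)\<^sup>2 < 1\<^sup>2"
      using k(2) final(4) unfolding ereal_less_eq(3) by simp
    then have "(1 + eps) ^ Suc k / ?n < 1"
      by (rule power_less_imp_less_base) simp
    then have "(1 + eps) ^ Suc k < ?n"
      using assms(2) by simp
    moreover have "card C \<le> Suc (Suc k)"
      using k(1) card_insert_le_m1[of "Suc (Suc k)" C' x] final(1) by simp
    ultimately show ?thesis
      using less_ceiling[of "Suc k"] by simp
  qed
qed

end
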